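(* Let $A$ be any $3\times 3$ real matrix. Then there exist unique $d,d_1,d_2,d_3,h_1,h_2,h_3,g\ge 0$ (subject to the conditions 1 and 2 in the definition of $F$ given in the context) and there exist permutation matrices $P,Q$ such that $$F(d,d_1,d_2,d_3,h_1,h_2,h_3,g)=P\odot A\odot Q .$$
   Context: $\mathbb{T}=\mathbb{R}\cup\{-\infty\}$ with tropical addition $a\oplus b=\max\{a,b\}$ and tropical multiplication $a\odot b=a+b$; matrices over $\mathbb{T}$ are multiplied in the usual way but with $\oplus,\odot$ in place of $+,\times$. For $t\in\mathbb{R}^3$, $\operatorname{diag}(t)$ is the $3\times3$ matrix with diagonal $t$ and all other entries $-\infty$ (a diagonal matrix). A permutation matrix is a matrix obtained from such a diagonal matrix by permuting some of its rows or some of its columns (so its finite entries may be arbitrary reals). For $d,d_1,d_2,d_3,h_1,h_2,h_3,g\ge0$, $$F(d,d_1,d_2,d_3,h_1,h_2,h_3,g)=\left[\begin{array}{ccc} 0&-d-d_2&-2d-d_3-h_3\\ -2d-d_1-h_1&0&-d-d_3-g\\ -d-d_1&-2d-d_2-h_2&0 \end{array}\right],$$ where the parameters are required to satisfy (subscripts modulo 3): condition 1: $h_{j+1}>0$ implies $d_j=0$, for $j=1,2,3$; condition 2: $g>0$ implies $d=d_1=h_3=0$.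
   Formalization: Uniqueness of the parameters is asserted only for each fixed pair P, Q, not over all P, Q: F(0,1,0,0,0,0,0,0) and F(0,0,1,0,0,0,0,0) are related by a cyclic relabelling, so the parameters are not determined by A alone. *)

theory Defs
  imports "HOL-Analysis.Analysis"
begin

datatype trop = NegInf | Fin real

text \<open>
  The max-plus semiring: the class operations \<open>+\<close>, \<open>*\<close>, \<open>0\<close>, \<open>1\<close> on \<open>trop\<close> are maximum, real
  addition, minus infinity and \<open>Fin 0\<close>. The library product \<open>**\<close> of matrices over \<open>trop\<close> is
  therefore the tropical matrix product.
\<close>

instantiation trop :: comm_semiring_1
begin

fun plus_trop :: "trop \<Rightarrow> trop \<Rightarrow> trop" where
  "NegInf + y = y"
| "x + NegInf = x"
| "Fin a + Fin b = Fin (max a b)"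

fun times_trop :: "trop \<Rightarrow> trop \<Rightarrow> trop" where
  "NegInf * y = NegInf"
| "x * NegInf = NegInf"
| "Fin a * Fin b = Fin (a + b)"

definition zero_trop :: trop where "0 = NegInf"

definition one_trop :: trop where "1 = Fin 0"

instance
proof
  fix a b c :: trop
  show "a + b + c = a + (b + c)"
    by (cases a; cases b; cases c) auto
  show "a + b = b + a"
    by (cases a; cases b) auto
  show "0 + a = a"
    by (simp add: zero_trop_def)
  show "a * b * c = a * (b * c)"
    by (cases a; cases b; cases c) auto
  show "a * b = b * a"
    by (cases a; cases b) auto
  show "1 * a = a"
    by (cases a) (auto simp: one_trop_def)
  show "(a + b) * c = a * c + b * c"
    by (cases a; cases b; cases c) auto
  show "0 * a = 0" "a * 0 = 0"
    by (cases a; simp add: zero_trop_def)+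
  show "(0::trop) \<noteq> 1"
    by (simp add: zero_trop_def one_trop_def)
qed

end

definition trop_diag :: "real^3 \<Rightarrow> trop^3^3" where
  "trop_diag t = (\<chi> i j. if i = j then Fin (t $ i) else NegInf)"

definition permutation_matrix :: "trop^3^3 \<Rightarrow> bool" where
  "permutation_matrix M \<longleftrightarrow> (\<exists>t \<sigma>. \<sigma> permutes UNIV \<and>
     (M = (\<chi> i j. trop_diag t $ \<sigma> i $ j) \<or> M = (\<chi> i j. trop_diag t $ i $ \<sigma> j)))"

definition F :: "real \<Rightarrow> real \<Rightarrow> real \<Rightarrow> real \<Rightarrow> real \<Rightarrow> real \<Rightarrow> real \<Rightarrow> real \<Rightarrow> real^3^3" where
  "F d d1 d2 d3 h1 h2 h3 g = vector [
     vector [0,              - d - d2,       -2*d - d3 - h3],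
     vector [-2*d - d1 - h1, 0,              - d - d3 - g  ],
     vector [- d - d1,       -2*d - d2 - h2, 0             ]]"

text \<open>
  The implications for \<open>h2\<close>, \<open>h3\<close>, \<open>h1\<close> are \<open>h(j+1) > 0 \<longrightarrow> d(j) = 0\<close> for \<open>j = 1, 2, 3\<close> with
  subscripts modulo 3.
\<close>

definition F_params :: "real \<Rightarrow> real \<Rightarrow> real \<Rightarrow> real \<Rightarrow> real \<Rightarrow> real \<Rightarrow> real \<Rightarrow> real \<Rightarrow> bool" where
  "F_params d d1 d2 d3 h1 h2 h3 g \<longleftrightarrow>
     0 \<le> d \<and> 0 \<le> d1 \<and> 0 \<le> d2 \<and> 0 \<le> d3 \<and> 0 \<le> h1 \<and> 0 \<le> h2 \<and> 0 \<le> h3 \<and> 0 \<le> g \<and>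
     (h2 > 0 \<longrightarrow> d1 = 0) \<and> (h3 > 0 \<longrightarrow> d2 = 0) \<and> (h1 > 0 \<longrightarrow> d3 = 0) \<and>
     (g > 0 \<longrightarrow> d = 0 \<and> d1 = 0 \<and> h3 = 0)"

end

theory Submission
  imports Defs
begin

text \<open>
  Multiplying by permutation matrices on both sides permutes the rows and the columns of \<open>A\<close> and
  adds constants to them (\<open>permutation_action\<close>). Write the sum of the entries of \<open>B\<close> along the
  graph of a permutation \<open>\<pi>\<close> as \<open>perm_sum B \<pi>\<close>. Two matrices arise from each other by adding
  constants to rows and columns exactly when their six permutation sums differ by one common
  constant; the direction that matters is \<open>diagonal_equivalence_if_perm_sums_eq\<close>. So existence
  is a question about six numbers that are subject to a single relation: the three even permutations
  partition the nine positions, and so do the three odd ones, hence both triples have the same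
  total.

  Permuting columns makes the identity sum the largest one. What then remains is to apply one permutation
  to rows and columns simultaneously. Reflections of the indices exchange the two 3-cycles, and
  rotations move the three transpositions cyclically. Therefore one may assume that
  the 3-cycle \<open>i \<mapsto> i + 1\<close> beats its inverse and that the transposition of 2 and 3 has the
  smallest sum among the transpositions (\<open>sorted_perm_sums_relabel\<close>). Now measure costs
  relative to the identity. If \<open>s1\<close> is the cost of \<open>i \<mapsto> i + 1\<close>, the costs of the
  transpositions exceed \<open>s1\<close> by \<open>h\<^sub>j\<^sub>+\<^sub>1 - d\<^sub>j\<close> when \<open>g = 0\<close>, so these parameters are forced
  to be positive and negative parts, and \<open>3 * d\<close> is what remains of \<open>s1\<close> after subtracting
  \<open>d\<^sub>1 + d\<^sub>2 + d\<^sub>3\<close>. This works unless that remainder is negative, and then the choice with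
  \<open>g > 0\<close> works (\<open>normal_form_of_sorted\<close>).

  Uniqueness for fixed \<open>P\<close> and \<open>Q\<close> means that the entries of \<open>F\<close> determine its
  parameters (\<open>F_params_eqI\<close>). The side conditions make \<open>d\<close> a minimum of six expressions in
  the entries when \<open>g = 0\<close>, and \<open>g > 0\<close> is visible in the entries as well.
\<close>

section \<open>Parameters are determined by the entries\<close>

text \<open>
  If \<open>g = 0\<close>, write \<open>a\<^sub>j = d + d\<^sub>j\<close> and \<open>b\<^sub>j = d + h\<^sub>j\<^sub>+\<^sub>1\<close>. Each \<open>a\<^sub>j\<close> is the negative of an
  entry, and each \<open>b\<^sub>j\<close> is a difference of entries. All six are at least \<open>d\<close>, and
  for every \<open>j\<close> one of \<open>a\<^sub>j\<close> and \<open>b\<^sub>j\<close> equals \<open>d\<close>; so \<open>d\<close> is their minimum.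
  The sign of \<open>(d + d3 + g) - (2 * d + d3 + h3) = g - d - h3\<close> tells whether \<open>g > 0\<close>.
\<close>

lemma F_params_eqI:
  assumes "F_params d d1 d2 d3 h1 h2 h3 g" "F_params d' d1' d2' d3' h1' h2' h3' g'"
    and "F d d1 d2 d3 h1 h2 h3 g = F d' d1' d2' d3' h1' h2' h3' g'"
  shows "(d, d1, d2, d3, h1, h2, h3, g) = (d', d1', d2', d3', h1', h2', h3', g')"
proof -
  have entries:
    "d + d1 = d' + d1'" "d + d2 = d' + d2'" "d + d3 + g = d' + d3' + g'"
    "2*d + d3 + h3 = 2*d' + d3' + h3'" "2*d + d1 + h1 = 2*d' + d1' + h1'"
    "2*d + d2 + h2 = 2*d' + d2' + h2'"
    using assms(3) by (simp_all add: F_def vec_eq_iff forall_3 vector_3)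
  have "g = g' \<and> d = d'"
    using assms(1,2) entries unfolding F_params_def by smt
  with assms(1,2) entries show ?thesis
    unfolding F_params_def by auto
qed

section \<open>The action of permutation matrices\<close>

lemma permutation_action:
  fixes B :: "real^3^3" and r s :: "3 \<Rightarrow> real"
  assumes "\<sigma> permutes UNIV" "\<tau> permutes UNIV"
  obtains P Q where "permutation_matrix P" "permutation_matrix Q"
    "P ** map_matrix Fin B ** Q = (\<chi> i j. Fin (B $ \<sigma> i $ \<tau> j + r i + s j))"
proof -
  define P where "P = (\<chi> i j. trop_diag (\<chi> k. r (inv \<sigma> k)) $ \<sigma> i $ j)"
  define Q where "Q = (\<chi> i j. trop_diag (\<chi> k. s (inv \<tau> k)) $ i $ \<tau> j)"
  have entries: "P $ i $ j = (if \<sigma> i = j then Fin (r i) else 0)"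
    "Q $ i $ j = (if i = \<tau> j then Fin (s j) else 0)" for i j
    using assms by (auto simp: P_def Q_def trop_diag_def zero_trop_def permutes_inverses)
  have "P ** map_matrix Fin B ** Q = (\<chi> i j. Fin (B $ \<sigma> i $ \<tau> j + r i + s j))"
    by (simp add: matrix_matrix_mult_def entries vec_eq_iff map_matrix_def if_distrib[of "\<lambda>x. x * _"]
          if_distrib[of "\<lambda>x. _ * x"] cong: if_cong)
  moreover have "permutation_matrix P" "permutation_matrix Q"
    unfolding permutation_matrix_def P_def Q_def using assms by blast+
  ultimately show thesis using that by blast
qed

section \<open>Permutations of three indices\<close>

text \<open>
  In the type \<open>3\<close> of residues modulo 3, \<open>3 = 0\<close>, and every permutation is affine: the even ones are
  \<open>i \<mapsto> i + k\<close> and the odd ones \<open>i \<mapsto> k - i\<close>. This turns conjugation of permutations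
  into arithmetic.
\<close>

lemma residues_mod_3:
  "1 + 1 = (2::3)" "2 + 1 = (3::3)" "3 + 1 = (1::3)" "1 + 2 = (3::3)" "2 + 2 = (1::3)" "3 + 2 = (2::3)"
  "0 - 1 = (2::3)" "0 - 2 = (1::3)" "0 - 3 = (3::3)" "1 - 1 = (3::3)" "1 - 2 = (2::3)" "1 - 3 = (1::3)"
  "2 - 1 = (1::3)" "2 - 2 = (3::3)" "2 - 3 = (2::3)"
  by simp_all

lemma permutes_identity: "(\<lambda>i. i) permutes S"
  using permutes_id by (simp add: id_def)

lemma permutes_shift: "(\<lambda>i::3. i + k) permutes UNIV"
  by (intro bij_imp_permutes) (simp_all add: bij_plus_right)

lemma permutes_reflect: "(\<lambda>i::3. k - i) permutes UNIV"
  by (rule bij_imp_permutes) (auto intro!: o_bij[of "\<lambda>i. k - i"])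

lemma permutes_3_cases:
  fixes \<pi> :: "3 \<Rightarrow> 3"
  assumes "\<pi> permutes UNIV"
  shows "\<pi> = (\<lambda>i. i) \<or> \<pi> = (\<lambda>i. i + 1) \<or> \<pi> = (\<lambda>i. i + 2) \<or>
    \<pi> = (\<lambda>i. 0 - i) \<or> \<pi> = (\<lambda>i. 1 - i) \<or> \<pi> = (\<lambda>i. 2 - i)"
proof -
  have "\<pi> 1 \<noteq> \<pi> 2" "\<pi> 1 \<noteq> \<pi> 3" "\<pi> 2 \<noteq> \<pi> 3"
    using permutes_inj[OF assms] by (simp_all add: inj_eq)
  then show ?thesis
    unfolding fun_eq_iff forall_3 residues_mod_3
    using exhaust_3[of "\<pi> 1"] exhaust_3[of "\<pi> 2"] exhaust_3[of "\<pi> 3"] by (elim disjE) simp_all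
qed

section \<open>Permutation sums\<close>

definition perm_sum :: "real^3^3 \<Rightarrow> (3 \<Rightarrow> 3) \<Rightarrow> real" where
  "perm_sum B \<pi> = (\<Sum>i\<in>UNIV. B $ i $ \<pi> i)"

lemma perm_sums:
  "perm_sum B (\<lambda>i. i) = B$1$1 + B$2$2 + B$3$3"
  "perm_sum B (\<lambda>i. i + 1) = B$1$2 + B$2$3 + B$3$1"
  "perm_sum B (\<lambda>i. i + 2) = B$1$3 + B$2$1 + B$3$2"
  "perm_sum B (\<lambda>i. 0 - i) = B$1$2 + B$2$1 + B$3$3"
  "perm_sum B (\<lambda>i. 1 - i) = B$1$3 + B$2$2 + B$3$1"
  "perm_sum B (\<lambda>i. 2 - i) = B$1$1 + B$2$3 + B$3$2"
  by (simp_all only: perm_sum_def sum_3 residues_mod_3)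


text \<open>
  Let \<open>E = C - D\<close>. Two permutations that agree in one position and differ by a transposition in
  the other two cut out a 2-by-2 minor, so equal permutation sums of \<open>E\<close> say that all minors
  satisfy \<open>E i j + E k l = E i l + E k j\<close>. Hence the first row and the first
  column of \<open>E\<close> determine it.
\<close>

lemma diagonal_equivalence_if_perm_sums_eq:
  fixes C D :: "real^3^3"
  assumes "\<And>\<pi>. \<pi> permutes UNIV \<Longrightarrow> perm_sum C \<pi> = perm_sum D \<pi> - c"
  obtains r s where "\<And>i j. C $ i $ j = D $ i $ j + r i + s j"
proof -
  define E where "E i j = C $ i $ j - D $ i $ j" for i j
  have sums: "perm_sum C (\<lambda>i. i) = perm_sum D (\<lambda>i. i) - c"
    "perm_sum C (\<lambda>i. i + 1) = perm_sum D (\<lambda>i. i + 1) - c"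
    "perm_sum C (\<lambda>i. i + 2) = perm_sum D (\<lambda>i. i + 2) - c"
    "perm_sum C (\<lambda>i. 0 - i) = perm_sum D (\<lambda>i. 0 - i) - c"
    "perm_sum C (\<lambda>i. 1 - i) = perm_sum D (\<lambda>i. 1 - i) - c"
    "perm_sum C (\<lambda>i. 2 - i) = perm_sum D (\<lambda>i. 2 - i) - c"
    using assms permutes_shift permutes_reflect permutes_identity by blast+
  have "E i j = (E i 1 - E 1 1) + E 1 j" for i j
  proof -
    have "\<forall>i j. E i j = (E i 1 - E 1 1) + E 1 j"
      using sums unfolding perm_sums E_def forall_3 by simp
    then show ?thesis by blast
  qed
  then have "C $ i $ j = D $ i $ j + (E i 1 - E 1 1) + E 1 j" for i j
    unfolding E_def by (smt (verit))
  then show thesis by (rule that)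
qed

section \<open>Sorting the permutation sums\<close>

lemma perm_sum_relabel:
  assumes "\<phi> permutes UNIV" and "\<And>i. \<phi> (\<rho> i) = \<rho>' (\<phi> i)"
  shows "perm_sum (\<chi> i j. B $ \<phi> i $ \<phi> j) \<rho> = perm_sum B \<rho>'"
  using sum.permute[OF assms(1), of "\<lambda>i. B $ i $ \<rho>' i"]
  by (simp add: perm_sum_def assms(2) o_def)

definition dominant_diagonal :: "real^3^3 \<Rightarrow> bool" where
  "dominant_diagonal B \<longleftrightarrow> (\<forall>\<rho>. \<rho> permutes UNIV \<longrightarrow> perm_sum B \<rho> \<le> perm_sum B (\<lambda>i. i))"

lemma dominant_diagonal_exists:
  obtains \<pi> where "\<pi> permutes UNIV" "dominant_diagonal (\<chi> i j. A $ i $ \<pi> j)"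
proof -
  define \<pi> where "\<pi> = arg_min_on (\<lambda>\<pi>. - perm_sum A \<pi>) {\<pi>. \<pi> permutes UNIV}"
  have fin: "finite {\<pi>. \<pi> permutes (UNIV :: 3 set)}" and ne: "{\<pi>. \<pi> permutes (UNIV :: 3 set)} \<noteq> {}"
    using permutes_identity[of UNIV] by auto
  have \<pi>: "\<pi> permutes UNIV"
    using arg_min_if_finite(1)[OF fin ne] unfolding \<pi>_def by blast
  have max: "perm_sum A \<rho> \<le> perm_sum A \<pi>" if "\<rho> permutes UNIV" for \<rho>
    using arg_min_least[OF fin ne, of \<rho> "\<lambda>\<pi>. - perm_sum A \<pi>"] that unfolding \<pi>_def by simp
  have "perm_sum A (\<lambda>i. \<pi> (\<rho> i)) \<le> perm_sum A \<pi>" if "\<rho> permutes UNIV" for \<rho>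
    using max permutes_compose[OF that \<pi>] by (simp add: o_def)
  then have "dominant_diagonal (\<chi> i j. A $ i $ \<pi> j)"
    by (simp add: dominant_diagonal_def perm_sum_def)
  with \<pi> show thesis by (rule that)
qed

lemma dominant_diagonal_relabel:
  assumes "dominant_diagonal B" "\<phi> permutes UNIV"
  shows "dominant_diagonal (\<chi> i j. B $ \<phi> i $ \<phi> j)"
proof -
  have "perm_sum (\<chi> i j. B $ \<phi> i $ \<phi> j) \<rho> \<le> perm_sum (\<chi> i j. B $ \<phi> i $ \<phi> j) (\<lambda>i. i)"
    if "\<rho> permutes UNIV" for \<rho>
  proof -
    have "perm_sum (\<chi> i j. B $ \<phi> i $ \<phi> j) \<rho> = perm_sum B (\<phi> \<circ> \<rho> \<circ> inv \<phi>)"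
      using assms(2) by (intro perm_sum_relabel) (simp_all add: permutes_inverses)
    also have "\<dots> \<le> perm_sum B (\<lambda>i. i)"
      using assms that unfolding dominant_diagonal_def
      by (meson permutes_compose permutes_inv)
    also have "\<dots> = perm_sum (\<chi> i j. B $ \<phi> i $ \<phi> j) (\<lambda>i. i)"
      by (rule perm_sum_relabel[symmetric]) (use assms(2) in simp_all)
    finally show ?thesis .
  qed
  then show ?thesis unfolding dominant_diagonal_def by blast
qed

text \<open>
  The permutation \<open>i \<mapsto> 2 - i\<close> fixes 1 and exchanges 2 and 3. Its cost in \<open>F\<close> is the only
  odd one that contains \<open>g\<close>, so the largest of the three costs is placed there.
\<close>

definition sorted_perm_sums :: "real^3^3 \<Rightarrow> bool" where
  "sorted_perm_sums B \<longleftrightarrow> dominant_diagonal B \<and>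
     perm_sum B (\<lambda>i. i + 2) \<le> perm_sum B (\<lambda>i. i + 1) \<and>
     (\<forall>k. perm_sum B (\<lambda>i. 2 - i) \<le> perm_sum B (\<lambda>i. k - i))"

text \<open>
  The reflection \<open>i \<mapsto> - i\<close> conjugates \<open>i \<mapsto> i + 1\<close> into its inverse. Rotations commute with both
  and act transitively on the transpositions.
\<close>

lemma sorted_perm_sums_relabel:
  assumes "dominant_diagonal B"
  obtains \<phi> where "\<phi> permutes UNIV" "sorted_perm_sums (\<chi> i j. B $ \<phi> i $ \<phi> j)"
proof -
  have neg: "(uminus :: 3 \<Rightarrow> 3) permutes UNIV"
    using permutes_reflect[of 0] by simp
  define \<alpha> :: "3 \<Rightarrow> 3"
    where "\<alpha> = (if perm_sum B (\<lambda>i. i + 2) \<le> perm_sum B (\<lambda>i. i + 1) then (\<lambda>i. i) else uminus)"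
  define C where "C = (\<chi> i j. B $ \<alpha> i $ \<alpha> j)"
  have \<alpha>: "\<alpha> permutes UNIV"
    unfolding \<alpha>_def by (split if_split) (intro conjI impI permutes_identity neg)
  have C2: "perm_sum C (\<lambda>i. i + 2) \<le> perm_sum C (\<lambda>i. i + 1)"
  proof (cases "perm_sum B (\<lambda>i. i + 2) \<le> perm_sum B (\<lambda>i. i + 1)")
    case True
    then show ?thesis by (simp add: C_def \<alpha>_def perm_sum_def)
  next
    case False
    have "perm_sum (\<chi> i j. B $ (- i) $ (- j)) (\<lambda>i. i + 2) = perm_sum B (\<lambda>i. i + 1)"
      "perm_sum (\<chi> i j. B $ (- i) $ (- j)) (\<lambda>i. i + 1) = perm_sum B (\<lambda>i. i + 2)"
      by (rule perm_sum_relabel[OF neg]; simp)+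
    with False show ?thesis by (simp add: C_def \<alpha>_def)
  qed
  define k where "k = arg_min_on (\<lambda>k. perm_sum C (\<lambda>i. k - i)) UNIV"
  have k: "perm_sum C (\<lambda>i. k - i) \<le> perm_sum C (\<lambda>i. l - i)" for l
    unfolding k_def by (rule arg_min_least) simp_all
  \<comment> \<open>Rotating by \<open>m\<close> carries \<open>i \<mapsto> 2 - i\<close> to \<open>i \<mapsto> 2 + 2 * m - i\<close>, so \<open>m\<close> solves
      \<open>2 + 2 * m = k\<close> modulo 3.\<close>
  define \<beta> where "\<beta> = (\<lambda>i. i + (2 - k))"
  have \<beta>: "\<beta> permutes UNIV"
    unfolding \<beta>_def by (rule permutes_shift)
  define D where "D = (\<chi> i j. C $ \<beta> i $ \<beta> j)"
  have shift: "perm_sum D (\<lambda>i. i + m) = perm_sum C (\<lambda>i. i + m)" for m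
    unfolding D_def by (rule perm_sum_relabel[OF \<beta>]) (simp add: \<beta>_def)
  have reflect: "perm_sum D (\<lambda>i. m - i) = perm_sum C (\<lambda>i. (m - 2 + k) - i)" for m
    unfolding D_def
  proof (rule perm_sum_relabel[OF \<beta>])
    have "\<forall>k::3. 2 - k + (2 - k) = - 2 + k"
      unfolding forall_3 by simp
    then show "\<beta> (m - i) = m - 2 + k - \<beta> i" for i
      unfolding \<beta>_def by (simp add: algebra_simps)
  qed
  have "dominant_diagonal D"
    unfolding D_def C_def using dominant_diagonal_relabel \<alpha> \<beta> assms by blast
  then have "sorted_perm_sums D"
    using C2 k by (simp add: sorted_perm_sums_def shift reflect)
  moreover have "D = (\<chi> i j. B $ (\<alpha> \<circ> \<beta>) i $ (\<alpha> \<circ> \<beta>) j)"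
    by (simp add: D_def C_def)
  ultimately show thesis
    using that permutes_compose[OF \<beta> \<alpha>] by metis
qed

section \<open>The normal form\<close>

text \<open>
  The equations between parameters and costs are linear once it is decided which parameters vanish.
  The sorted order is needed to exclude the arrangements of costs that no choice realises.
\<close>

lemma normal_form_of_sorted:
  assumes "sorted_perm_sums B"
  obtains d d1 d2 d3 h1 h2 h3 g where "F_params d d1 d2 d3 h1 h2 h3 g"
    "\<And>\<pi>. \<pi> permutes UNIV \<Longrightarrow> perm_sum (F d d1 d2 d3 h1 h2 h3 g) \<pi> = perm_sum B \<pi> - perm_sum B (\<lambda>i. i)"
proof -
  define cost where "cost \<pi> = perm_sum B (\<lambda>i. i) - perm_sum B \<pi>" for \<pi>
  define s1 s2 q1 q2 q3 where "s1 = cost (\<lambda>i. i + 1)" and "s2 = cost (\<lambda>i. i + 2)"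
    and "q1 = cost (\<lambda>i. 2 - i)" and "q2 = cost (\<lambda>i. 1 - i)" and "q3 = cost (\<lambda>i. 0 - i)"
  note costs = s1_def s2_def q1_def q2_def q3_def
  have dominant: "perm_sum B \<rho> \<le> perm_sum B (\<lambda>i. i)" if "\<rho> permutes UNIV" for \<rho>
    using assms that unfolding sorted_perm_sums_def dominant_diagonal_def by blast
  have nonneg: "0 \<le> s1" "0 \<le> q2" "0 \<le> q3"
    using dominant[OF permutes_shift] dominant[OF permutes_reflect] unfolding costs cost_def
    by (simp_all only: diff_ge_0_iff_ge)
  have order: "s1 \<le> s2" "q2 \<le> q1" "q3 \<le> q1"
    using assms unfolding sorted_perm_sums_def costs cost_def by (blast intro: diff_left_mono)+
  have total: "s1 + s2 = q1 + q2 + q3"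
    unfolding costs cost_def perm_sums by simp
  note conclude = that
  \<comment> \<open>The left-hand sides are the costs in \<open>F\<close> of the five permutations other than the identity.\<close>
  have reduce: thesis if "F_params d d1 d2 d3 h1 h2 h3 g"
    "3*d + d1 + d2 + d3 + g = s1" "6*d + d1 + d2 + d3 + h1 + h2 + h3 = s2"
    "3*d + d2 + d3 + h2 + g = q1" "3*d + d1 + d3 + h3 = q2" "3*d + d1 + d2 + h1 = q3"
    for d d1 d2 d3 h1 h2 h3 g
  proof (rule conclude)
    have sums: "perm_sum (F d d1 d2 d3 h1 h2 h3 g) (\<lambda>i. i) = 0"
      "perm_sum (F d d1 d2 d3 h1 h2 h3 g) (\<lambda>i. i + 1) = - s1"
      "perm_sum (F d d1 d2 d3 h1 h2 h3 g) (\<lambda>i. i + 2) = - s2"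
      "perm_sum (F d d1 d2 d3 h1 h2 h3 g) (\<lambda>i. 2 - i) = - q1"
      "perm_sum (F d d1 d2 d3 h1 h2 h3 g) (\<lambda>i. 1 - i) = - q2"
      "perm_sum (F d d1 d2 d3 h1 h2 h3 g) (\<lambda>i. 0 - i) = - q3"
      using that(2-6) unfolding perm_sums F_def by simp_all
    show "perm_sum (F d d1 d2 d3 h1 h2 h3 g) \<pi> = perm_sum B \<pi> - perm_sum B (\<lambda>i. i)"
      if "\<pi> permutes UNIV" for \<pi>
      using permutes_3_cases[OF that] sums by (auto simp: costs cost_def)
  qed fact
  \<comment> \<open>For \<open>g = 0\<close> the odd costs are \<open>q\<^sub>j = s1 - d\<^sub>j + h\<^sub>j\<^sub>+\<^sub>1\<close>. As at most one of \<open>d\<^sub>j\<close> and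
      \<open>h\<^sub>j\<^sub>+\<^sub>1\<close> is nonzero, they must be the positive and the negative part of \<open>s1 - q\<^sub>j\<close>.\<close>
  define p1 n1 p2 n2 p3 n3 where "p1 = max 0 (s1 - q1)" and "n1 = max 0 (q1 - s1)"
    and "p2 = max 0 (s1 - q2)" and "n2 = max 0 (q2 - s1)"
    and "p3 = max 0 (s1 - q3)" and "n3 = max 0 (q3 - s1)"
  have parts: "0 \<le> p1" "0 \<le> n1" "0 \<le> p2" "0 \<le> n2" "0 \<le> p3" "0 \<le> n3"
    "n1 > 0 \<longrightarrow> p1 = 0" "n2 > 0 \<longrightarrow> p2 = 0" "n3 > 0 \<longrightarrow> p3 = 0"
    "p1 - n1 = s1 - q1" "p2 - n2 = s1 - q2" "p3 - n3 = s1 - q3"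
    by (auto simp: p1_def n1_def p2_def n2_def p3_def n3_def)
  show thesis
  proof (cases "p1 + p2 + p3 \<le> s1")
    case True
    define d where "d = (s1 - (p1 + p2 + p3)) / 3"
    have "3 * d = s1 - (p1 + p2 + p3)"
      by (simp add: d_def)
    with True show thesis
      using parts total by (intro reduce[of d p1 p2 p3 n3 n1 n2 0]) (auto simp: F_params_def)
  next
    case False
    \<comment> \<open>If at most one of the three costs is below \<open>s1\<close>, the sum of the \<open>p\<close> is at most \<open>s1\<close>
        because costs are nonnegative; if none is above, it is \<open>3 * s1 - (q1 + q2 + q3) = 2 * s1 - s2\<close>,
        which is at most \<open>s1\<close> as well. So exactly two are below, and \<open>q1\<close>, the largest, is not.\<close>
    then have "s1 \<le> q1" "q2 + q3 < s1"
      using total nonneg order by (auto simp: p1_def p2_def p3_def max_def split: if_splits)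
    then show thesis
      using total nonneg by (intro reduce[of 0 0 q3 q2 0 "q1 - s1" 0 "s1 - q2 - q3"])
        (auto simp: F_params_def)
  qed
qed

theorem theorem1:
  fixes A :: "real^3^3"
  shows "(\<exists>d d1 d2 d3 h1 h2 h3 g P Q.
             F_params d d1 d2 d3 h1 h2 h3 g \<and> permutation_matrix P \<and> permutation_matrix Q \<and>
             map_matrix Fin (F d d1 d2 d3 h1 h2 h3 g) = P ** map_matrix Fin A ** Q) \<and>
         (\<forall>P Q. permutation_matrix P \<longrightarrow> permutation_matrix Q \<longrightarrow>
            (\<exists>\<^sub>\<le>\<^sub>1 (d, d1, d2, d3, h1, h2, h3, g).
               F_params d d1 d2 d3 h1 h2 h3 g \<and>
               map_matrix Fin (F d d1 d2 d3 h1 h2 h3 g) = P ** map_matrix Fin A ** Q))"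
proof (intro conjI allI impI)
  obtain \<pi> where \<pi>: "\<pi> permutes UNIV" and dom: "dominant_diagonal (\<chi> i j. A $ i $ \<pi> j)"
    by (rule dominant_diagonal_exists)
  obtain \<phi> where \<phi>: "\<phi> permutes UNIV" and sorted: "sorted_perm_sums (\<chi> i j. A $ \<phi> i $ \<pi> (\<phi> j))"
    using sorted_perm_sums_relabel[OF dom] by auto
  define B where "B = (\<chi> i j. A $ \<phi> i $ \<pi> (\<phi> j))"
  obtain d d1 d2 d3 h1 h2 h3 g where params: "F_params d d1 d2 d3 h1 h2 h3 g"
    and sums: "\<And>\<rho>. \<rho> permutes UNIV \<Longrightarrow>
      perm_sum (F d d1 d2 d3 h1 h2 h3 g) \<rho> = perm_sum B \<rho> - perm_sum B (\<lambda>i. i)"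
    using normal_form_of_sorted[OF sorted[folded B_def]] by blast
  obtain r s where rs: "\<And>i j. F d d1 d2 d3 h1 h2 h3 g $ i $ j = B $ i $ j + r i + s j"
    using diagonal_equivalence_if_perm_sums_eq[OF sums] by blast
  obtain P Q where "permutation_matrix P" "permutation_matrix Q"
    "P ** map_matrix Fin A ** Q = (\<chi> i j. Fin (A $ \<phi> i $ (\<pi> \<circ> \<phi>) j + r i + s j))"
    using permutation_action[OF \<phi> permutes_compose[OF \<phi> \<pi>]] .
  moreover from this have "map_matrix Fin (F d d1 d2 d3 h1 h2 h3 g) = P ** map_matrix Fin A ** Q"
    by (simp add: map_matrix_def rs B_def)
  ultimately show "\<exists>d d1 d2 d3 h1 h2 h3 g P Q.
      F_params d d1 d2 d3 h1 h2 h3 g \<and> permutation_matrix P \<and> permutation_matrix Q \<and>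
      map_matrix Fin (F d d1 d2 d3 h1 h2 h3 g) = P ** map_matrix Fin A ** Q"
    using params by blast
next
  fix P Q :: "trop^3^3"
  have "X = Y" if "map_matrix Fin X = M" "map_matrix Fin Y = M" for X Y :: "real^3^3" and M
    using that by (simp add: map_matrix_def vec_eq_iff) (metis trop.inject)
  then show "\<exists>\<^sub>\<le>\<^sub>1 (d, d1, d2, d3, h1, h2, h3, g).
      F_params d d1 d2 d3 h1 h2 h3 g \<and>
      map_matrix Fin (F d d1 d2 d3 h1 h2 h3 g) = P ** map_matrix Fin A ** Q"
    unfolding Uniq_def using F_params_eqI by fast
qed

end
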